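(* Let $A=(a_{i,j})\in M_n(\mathbb N)$ and $h,k\in[1,n]$. Then $A$ satisfies the SDP condition at $(h,k)$ if and only if $a_{h,k}>0$ and $a_{i,j}=0$ for all $i>h$ and $j<k$ (equivalently, $a_{h,k}>0$ and the lower left corner matrix of $A$ at $(h,k)$, i.e. the submatrix of $A$ with rows $i>h$ and columns $j<k$, is $0$).
   Context: $\mathbb N$ is the set of non-negative integers, $[1,n]=\{1,\dots,n\}$, $M_n(\mathbb N)$ is the set of $n\times n$ matrices over $\mathbb N$, and $|A|$ is the sum of the entries of $A$. Let $R$ be a commutative ring with $1$ and $q\in R$ a unit with $q\neq 1$. An empty lower left corner matrix (when $k=1$ or $h=n$) is regarded as $0$. Hecke--Clifford superalgebra: $\mathcal H^c_{r,R}$ is the associative $R$-superalgebra generated by even $T_1,\dots,T_{r-1}$ and odd $c_1,\dots,c_r$ subject to $c_i^2=-1$, $c_ic_j=-c_jc_i$ ($i\ne j$); $(T_i-q)(T_i+1)=0$, $T_iT_j=T_jT_i$ ($|i-j|>1$), $T_iT_{i+1}T_i=T_{i+1}T_iT_{i+1}$; $c_jT_i=T_ic_j$ ($j\ne i,i+1$), $c_{i+1}T_i=T_ic_i$, $c_iT_i=T_ic_{i+1}+(q-1)(c_i-c_{i+1})$. In the symmetric group $\mathfrak S_r$ (permutations composed right to left) let $s_i=(i,i+1)$, and put $T_w=T_{i_1}\cdots T_{i_k}$ for any reduced expression $w=s_{i_1}\cdots s_{i_k}$. For $A=(a_{i,j})\in M_n(\mathbb N)$ with $r=|A|$ let $\lambda=\mathrm{ro}(A)=(\sum_ja_{1,j},\dots,\sum_ja_{n,j})$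 and $\widetilde\lambda_i=\lambda_1+\cdots+\lambda_i$, $\widetilde\lambda_0=0$. Put $\widetilde a_{i,j}=\sum_{p=1}^{j-1}\sum_{u=1}^na_{u,p}+\sum_{u=1}^ia_{u,j}$ ($0\le i\le n$) and $\widehat a_{h,k-1}=\widetilde\lambda_{h-1}+\sum_{u=1}^{k-1}a_{h,u}$. The permutation $d_A\in\mathfrak S_r$ is given by $d_A(\widetilde a_{h-1,k}+p)=\widehat a_{h,k-1}+p$ for all $h,k\in[1,n]$ with $a_{h,k}>0$ and $p\in[1,a_{h,k}]$ (it is the distinguished double coset representative associated with $A$). SDP condition: $A$ satisfies the SDP (semi-direct product) condition at $(h,k)$ if $a_{h,k}>0$ and $c_{\widehat a_{h,k-1}+p}\,T_{d_A}=T_{d_A}\,c_{\widetilde a_{h-1,k}+p}$ in $\mathcal H^c_{r,R}$ for every $p\in[1,a_{h,k}]$. *)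

theory Defs
  imports
    "HOL-Library.Poly_Mapping"
    "HOL-Combinatorics.Permutations"
    "HOL-Algebra.QuotRing"
    "Jordan_Normal_Form.Matrix"
    "Jordan_Normal_Form.DL_Submatrix"
begin

section \<open>Free associative algebras\<close>

text \<open>The free monoid on \<open>'g\<close>, written additively, so that the type \<open>'g fword \<Rightarrow>\<^sub>0 'a\<close>
  with the convolution product of \<^theory>\<open>HOL-Library.Poly_Mapping\<close> is the free associative
  algebra on \<open>'g\<close> over the commutative ring \<open>'a\<close>.\<close>

datatype 'g fword = FWord (letters: "'g list")

instantiation fword :: (type) monoid_add
begin

definition zero_fword :: "'g fword" where
  "zero_fword = FWord []"

definition plus_fword :: "'g fword \<Rightarrow> 'g fword \<Rightarrow> 'g fword" where
  "plus_fword u v = FWord (letters u @ letters v)"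

instance
  by standard (simp_all add: zero_fword_def plus_fword_def)

end

definition fgen :: "'g \<Rightarrow> 'g fword \<Rightarrow>\<^sub>0 'a::comm_ring_1" where
  "fgen g = Poly_Mapping.single (FWord [g]) 1"

definition fscal :: "'a::comm_ring_1 \<Rightarrow> 'g fword \<Rightarrow>\<^sub>0 'a" where
  "fscal a = Poly_Mapping.single 0 a"

definition free_algebra :: "'g set \<Rightarrow> ('g fword \<Rightarrow>\<^sub>0 'a::comm_ring_1) ring" where
  "free_algebra X =
     \<lparr>carrier = {f. \<forall>w \<in> Poly_Mapping.keys f. set (letters w) \<subseteq> X},
      monoid.mult = (*), one = 1, zero = 0, add = (+)\<rparr>"

lemma ring_free_algebra: "ring (free_algebra X :: ('g fword \<Rightarrow>\<^sub>0 'a::comm_ring_1) ring)"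
proof -
  let ?C = "{f :: 'g fword \<Rightarrow>\<^sub>0 'a. \<forall>w \<in> Poly_Mapping.keys f. set (letters w) \<subseteq> X}"
  have add: "f + g \<in> ?C" if "f \<in> ?C" "g \<in> ?C" for f g
    using that Poly_Mapping.keys_add[of f g] by blast
  have mult: "f * g \<in> ?C" if "f \<in> ?C" "g \<in> ?C" for f g
    using that keys_mult[of f g] by (fastforce simp: plus_fword_def)
  have one: "1 \<in> ?C"
    by (simp add: single_one[symmetric] zero_fword_def del: single_one)
  have uminus: "- f \<in> ?C" if "f \<in> ?C" for f
    using that by simp
  define F where "F = (free_algebra X :: ('g fword \<Rightarrow>\<^sub>0 'a) ring)"
  have carr: "carrier F = ?C"
    and ops [simp]: "f \<otimes>\<^bsub>F\<^esub> g = f * g" "f \<oplus>\<^bsub>F\<^esub> g = f + g" "\<one>\<^bsub>F\<^esub> = 1" "\<zero>\<^bsub>F\<^esub> = 0" for f g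
    by (simp_all add: F_def free_algebra_def)
  have closed [simp]:
    "f \<in> carrier F \<Longrightarrow> g \<in> carrier F \<Longrightarrow> f + g \<in> carrier F"
    "f \<in> carrier F \<Longrightarrow> g \<in> carrier F \<Longrightarrow> f * g \<in> carrier F"
    "f \<in> carrier F \<Longrightarrow> - f \<in> carrier F" "1 \<in> carrier F" "0 \<in> carrier F" for f g
    unfolding carr by (fact add, fact mult, fact uminus, fact one, simp)
  have "ring F"
  proof (intro ringI abelian_groupI monoidI)
    fix f
    assume f: "f \<in> carrier F"
    show "\<exists>g \<in> carrier F. g \<oplus>\<^bsub>F\<^esub> f = \<zero>\<^bsub>F\<^esub>"
      by (rule bexI[of _ "- f"]) (use f in simp_all)
  qed (simp_all add: algebra_simps)
  then show ?thesis
    unfolding F_def .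
qed


section \<open>The Hecke--Clifford superalgebra\<close>

text \<open>\<open>Hk i\<close> and \<open>Cl i\<close> stand for the even generator $T_i$ and the odd generator $c_i$.\<close>

datatype hc_gen = Hk nat | Cl nat

definition hc_gens :: "nat \<Rightarrow> hc_gen set" where
  "hc_gens r = Hk ` {1..<r} \<union> Cl ` {1..r}"

definition hc_free :: "'a::comm_ring_1 itself \<Rightarrow> nat \<Rightarrow> (hc_gen fword \<Rightarrow>\<^sub>0 'a) ring" where
  "hc_free _ r = free_algebra (hc_gens r)"

text \<open>A defining relation $x = y$ is represented by the element $x - y$ of the free algebra.\<close>

definition hc_rels :: "nat \<Rightarrow> 'a::comm_ring_1 \<Rightarrow> (hc_gen fword \<Rightarrow>\<^sub>0 'a) set" where
  "hc_rels r q =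
     (let T = (\<lambda>i. fgen (Hk i)); c = (\<lambda>i. fgen (Cl i)) in
       {c i * c i - fscal (- 1) | i. i \<in> {1..r}}
     \<union> {c i * c j - (- (c j * c i)) | i j. i \<in> {1..r} \<and> j \<in> {1..r} \<and> i \<noteq> j}
     \<union> {(T i - fscal q) * (T i + 1) | i. i \<in> {1..<r}}
     \<union> {T i * T j - T j * T i | i j.
          i \<in> {1..<r} \<and> j \<in> {1..<r} \<and> \<bar>int i - int j\<bar> > 1}
     \<union> {T i * T (i + 1) * T i - T (i + 1) * T i * T (i + 1) | i.
          i \<in> {1..<r} \<and> i + 1 \<in> {1..<r}}
     \<union> {c j * T i - T i * c j | i j. i \<in> {1..<r} \<and> j \<in> {1..r} \<and> j \<noteq> i \<and> j \<noteq> i + 1}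
     \<union> {c (i + 1) * T i - T i * c i | i. i \<in> {1..<r}}
     \<union> {c i * T i - (T i * c (i + 1) + fscal (q - 1) * (c i - c (i + 1))) | i. i \<in> {1..<r}})"

definition hc_ideal :: "nat \<Rightarrow> 'a::comm_ring_1 \<Rightarrow> (hc_gen fword \<Rightarrow>\<^sub>0 'a) set" where
  "hc_ideal r q = Idl\<^bsub>hc_free TYPE('a) r\<^esub> (hc_rels r q)"

text \<open>The relations are homogeneous for the parity of the number of letters \<open>Cl i\<close>, so the
  quotient inherits the $\mathbb{Z}/2$-grading, and $R$ acts through the images of \<open>fscal\<close>;
  neither is recorded in the ring structure, which is all that equations between elements
  involve.\<close>

definition hecke_clifford ::
    "nat \<Rightarrow> 'a::comm_ring_1 \<Rightarrow> (hc_gen fword \<Rightarrow>\<^sub>0 'a) set ring" where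
  "hecke_clifford r q = hc_free TYPE('a) r Quot hc_ideal r q"

definition hc_T :: "nat \<Rightarrow> 'a::comm_ring_1 \<Rightarrow> nat \<Rightarrow> (hc_gen fword \<Rightarrow>\<^sub>0 'a) set" where
  "hc_T r q i = hc_ideal r q +>\<^bsub>hc_free TYPE('a) r\<^esub> fgen (Hk i)"

definition hc_c :: "nat \<Rightarrow> 'a::comm_ring_1 \<Rightarrow> nat \<Rightarrow> (hc_gen fword \<Rightarrow>\<^sub>0 'a) set" where
  "hc_c r q i = hc_ideal r q +>\<^bsub>hc_free TYPE('a) r\<^esub> fgen (Cl i)"


section \<open>Reduced expressions and the elements $T_w$\<close>

definition simple_prod :: "nat list \<Rightarrow> nat \<Rightarrow> nat" where
  "simple_prod is = foldr (\<lambda>i w. transpose i (i + 1) \<circ> w) is id"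

definition reduced_expr :: "nat \<Rightarrow> (nat \<Rightarrow> nat) \<Rightarrow> nat list \<Rightarrow> bool" where
  "reduced_expr r w is \<longleftrightarrow>
     set is \<subseteq> {1..<r} \<and> simple_prod is = w \<and>
     (\<forall>js. set js \<subseteq> {1..<r} \<and> simple_prod js = w \<longrightarrow> length is \<le> length js)"

definition hc_T_word ::
    "nat \<Rightarrow> 'a::comm_ring_1 \<Rightarrow> nat list \<Rightarrow> (hc_gen fword \<Rightarrow>\<^sub>0 'a) set" where
  "hc_T_word r q is =
     foldr (\<lambda>i x. hc_T r q i \<otimes>\<^bsub>hecke_clifford r q\<^esub> x) is \<one>\<^bsub>hecke_clifford r q\<^esub>"

text \<open>By the braid relations and Matsumoto's theorem the value is the same for every
  reduced expression.\<close>

definition hc_T_perm ::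
    "nat \<Rightarrow> 'a::comm_ring_1 \<Rightarrow> (nat \<Rightarrow> nat) \<Rightarrow> (hc_gen fword \<Rightarrow>\<^sub>0 'a) set" where
  "hc_T_perm r q w = hc_T_word r q (SOME is. reduced_expr r w is)"


section \<open>Matrices over the natural numbers\<close>

text \<open>Matrices are indexed from 0 in the library; \<open>entry\<close> indexes them from 1.\<close>

definition entry :: "nat mat \<Rightarrow> nat \<Rightarrow> nat \<Rightarrow> nat" where
  "entry A i j = A $$ (i - 1, j - 1)"

definition msum :: "nat mat \<Rightarrow> nat" where
  "msum A = (\<Sum>i = 1..dim_row A. \<Sum>j = 1..dim_col A. entry A i j)"

definition ro :: "nat mat \<Rightarrow> nat \<Rightarrow> nat" where
  "ro A i = (\<Sum>j = 1..dim_col A. entry A i j)"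

definition a_tilde :: "nat mat \<Rightarrow> nat \<Rightarrow> nat \<Rightarrow> nat" where
  "a_tilde A i j =
     (\<Sum>p = 1..j - 1. \<Sum>u = 1..dim_row A. entry A u p) + (\<Sum>u = 1..i. entry A u j)"

text \<open>The second argument is the subscript as written: \<open>a_hat A h (k - 1)\<close> is
  $\widehat a_{h,k-1}$.\<close>

definition a_hat :: "nat mat \<Rightarrow> nat \<Rightarrow> nat \<Rightarrow> nat" where
  "a_hat A h l = (\<Sum>i = 1..h - 1. ro A i) + (\<Sum>u = 1..l. entry A h u)"

definition d_perm :: "nat mat \<Rightarrow> nat \<Rightarrow> nat" where
  "d_perm A = (THE d. d permutes {1..msum A} \<and>
     (\<forall>h \<in> {1..dim_row A}. \<forall>k \<in> {1..dim_col A}. \<forall>p \<in> {1..entry A h k}.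
        d (a_tilde A (h - 1) k + p) = a_hat A h (k - 1) + p))"

definition SDP :: "nat mat \<Rightarrow> 'a::comm_ring_1 \<Rightarrow> nat \<Rightarrow> nat \<Rightarrow> bool" where
  "SDP A q h k \<longleftrightarrow>
     entry A h k > 0 \<and>
     (\<forall>p \<in> {1..entry A h k}.
        hc_c (msum A) q (a_hat A h (k - 1) + p)
          \<otimes>\<^bsub>hecke_clifford (msum A) q\<^esub> hc_T_perm (msum A) q (d_perm A)
        = hc_T_perm (msum A) q (d_perm A)
          \<otimes>\<^bsub>hecke_clifford (msum A) q\<^esub> hc_c (msum A) q (a_tilde A (h - 1) k + p))"

text \<open>In the 0-based indexing of the library, the rows $i > h$ are \<open>{h..<dim_row A}\<close> and the
  columns $j < k$ are \<open>{..<k - 1}\<close>. If one of these is empty, the result is the zero matrix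
  of the respective (degenerate) dimensions.\<close>

definition lower_left_corner :: "nat mat \<Rightarrow> nat \<Rightarrow> nat \<Rightarrow> nat mat" where
  "lower_left_corner A h k = submatrix A {h..<dim_row A} {..<k - 1}"

end

theory Submission
  imports Defs
begin

text \<open>Write \<open>w\<close> for a permutation and \<open>j\<close> for a position. Moving $c_j$ from right to left through a reduced
  expression of $T_w$, one letter at a time, uses only the relations $c_{i+1} T_i = T_i c_i$ and
  $c_l T_i = T_i c_l$, unless some $a < j$ has $w(a) > w(j)$; so without such an inversion
  $c_{w(j)} T_w = T_w c_j$. Conversely, let the algebra act on the Clifford algebra, the module induced
  from the one-dimensional module $T_i \mapsto q$ of the Hecke algebra. If $M = w(m)$ is the maximum of
  $w$ on the positions up to \<open>j\<close>, then the coefficient of $c_M$ in $T_w c_j \cdot 1$ is $q^{\ell(w)}$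
  if $m = j$ and $q^{\ell(w)-1}(q-1)$ otherwise. The latter is nonzero since \<open>q\<close> is a unit different
  from 1, whereas the coefficient in $c_{w(j)} T_w \cdot 1 = q^{\ell(w)} c_{w(j)}$ is then 0.

  For $w = d_A$ the positions \<open>j\<close> run through the cells of \<open>A\<close> column by column and the values $w(j)$
  row by row. Hence the inversions of the kind above at a cell of block $(h,k)$ are exactly the cells of
  the lower left corner.\<close>


section \<open>Reduced expressions\<close>

lemma simple_prod_Nil [simp]: "simple_prod [] = id"
  by (simp add: simple_prod_def)

lemma simple_prod_Cons [simp]: "simple_prod (i # is) = transpose i (i + 1) \<circ> simple_prod is"
  by (simp add: simple_prod_def)

lemma simple_prod_append [simp]: "simple_prod (is @ js) = simple_prod is \<circ> simple_prod js"
  by (induction "is") (simp_all add: comp_assoc)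

lemma bij_simple_prod: "bij (simple_prod is)"
  by (induction "is") (simp_all only: simple_prod_Nil simple_prod_Cons bij_id bij_comp bij_transpose)

lemma simple_prod_eq_iff [simp]: "simple_prod is a = simple_prod is b \<longleftrightarrow> a = b"
  using bij_simple_prod[of "is"] by (auto dest: bij_is_inj injD)

text \<open>The exchange condition, by induction on the first letter. If the tail already has the
  descent, delete a letter there. Otherwise the first letter creates the descent, and it is the
  letter to delete.\<close>

lemma simple_prod_exchange:
  assumes "simple_prod is (i + 1) < simple_prod is i"
  shows "\<exists>js. set js \<subseteq> set is \<and> Suc (length js) = length is \<and>
           simple_prod js = simple_prod is \<circ> transpose i (i + 1)"
  using assms
proof (induction "is")
  case Nil
  then show ?case by simp
next
  case (Cons x xs)
  let ?w = "simple_prod xs"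
  show ?case
  proof (cases "?w (i + 1) < ?w i")
    case True
    with Cons.IH obtain js where "set js \<subseteq> set xs" "Suc (length js) = length xs"
      "simple_prod js = ?w \<circ> transpose i (i + 1)" by blast
    then show ?thesis
      by (intro exI[of _ "x # js"]) (auto simp: comp_assoc)
  next
    case False
    have "?w i \<noteq> ?w (i + 1)" by simp
    with False have less: "?w i < ?w (i + 1)" by linarith
    \<comment> \<open>A simple transposition reverses the order of two values only if they are the
      two values that it swaps.\<close>
    with Cons.prems have eq: "?w i = x" "?w (i + 1) = x + 1"
      by (auto simp: transpose_def split: if_splits)
    \<comment> \<open>Conjugating $s_i$ by \<open>?w\<close> gives $s_x$, so the two outer
      transpositions cancel.\<close>
    have "?w = transpose x (x + 1) \<circ> ?w \<circ> transpose i (i + 1)"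
    proof
      fix a
      have "?w a = x \<longleftrightarrow> a = i" "?w a = x + 1 \<longleftrightarrow> a = i + 1"
        using eq by (metis simple_prod_eq_iff)+
      then show "?w a = (transpose x (x + 1) \<circ> ?w \<circ> transpose i (i + 1)) a"
        using eq by (auto simp: transpose_def)
    qed
    then have "simple_prod xs = simple_prod (x # xs) \<circ> transpose i (i + 1)"
      by (simp only: simple_prod_Cons)
    then show ?thesis
      by (intro exI[of _ xs] conjI) (simp_all only: set_subset_Cons list.size add_Suc_right add_0_right)
  qed
qed

text \<open>These are all the properties of reduced expressions that are needed; the indices are not bounded
  by any \<open>r\<close>.\<close>

inductive increasing_word :: "nat list \<Rightarrow> bool" where
  increasing_Nil: "increasing_word []"
| increasing_snoc: "increasing_word is \<Longrightarrow> simple_prod is i < simple_prod is (i + 1) \<Longrightarrow>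
    increasing_word (is @ [i])"

text \<open>Prefixes of reduced words are reduced, and a descent before the last letter would let
  the exchange condition replace the whole word by one that is two letters shorter.\<close>

lemma reduced_expr_increasing:
  assumes "reduced_expr r w is"
  shows "increasing_word is"
  using assms
proof (induction "is" arbitrary: w rule: rev_induct)
  case Nil
  show ?case by (rule increasing_Nil)
next
  case (snoc i "is")
  from snoc.prems have sub: "set is \<subseteq> {1..<r}" "i \<in> {1..<r}"
    and w: "w = simple_prod is \<circ> transpose i (i + 1)"
    and min: "\<And>js. set js \<subseteq> {1..<r} \<Longrightarrow> simple_prod js = w \<Longrightarrow> Suc (length is) \<le> length js"
    by (auto simp: reduced_expr_def)
  have "reduced_expr r (simple_prod is) is"
    unfolding reduced_expr_def
  proof (intro conjI allI impI)
    fix js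
    assume "set js \<subseteq> {1..<r} \<and> simple_prod js = simple_prod is"
    then show "length is \<le> length js"
      using min[of "js @ [i]"] sub w by simp
  qed (use sub in auto)
  then have "increasing_word is" by (rule snoc.IH)
  moreover have "\<not> simple_prod is (i + 1) < simple_prod is i"
  proof
    assume "simple_prod is (i + 1) < simple_prod is i"
    from simple_prod_exchange[OF this] obtain js where "set js \<subseteq> set is"
      "Suc (length js) = length is" "simple_prod js = w" by (auto simp: w)
    with min[of js] sub show False by auto
  qed
  then have "simple_prod is i < simple_prod is (i + 1)"
    by (metis linorder_neqE_nat simple_prod_eq_iff n_not_Suc_n Suc_eq_plus1)
  ultimately show ?case by (rule increasing_snoc)
qed

text \<open>Conjugating the transposition of $a$ and $b$ by $s_b$ moves the upper point one step
  further.\<close>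

lemma transpose_simple_prod:
  assumes "1 \<le> a"
  shows "a + Suc m \<le> r \<Longrightarrow> \<exists>is. set is \<subseteq> {1..<r} \<and> simple_prod is = transpose a (a + Suc m)"
proof (induction m)
  case 0
  then show ?case
    using assms by (intro exI[of _ "[a]"]) auto
next
  case (Suc m)
  then obtain "is" where "is": "set is \<subseteq> {1..<r}" "simple_prod is = transpose a (a + Suc m)"
    by auto
  let ?i = "a + Suc m"
  have "simple_prod (?i # is @ [?i]) = transpose a (a + Suc (Suc m))"
    unfolding simple_prod_Cons simple_prod_append simple_prod_Nil "is"
    by (auto simp: fun_eq_iff transpose_def)
  then show ?case
    using "is"(1) Suc.prems assms by (intro exI[of _ "?i # is @ [?i]"]) auto
qed

lemma permutes_simple_prod:
  assumes "w permutes {1..r}"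
  shows "\<exists>is. set is \<subseteq> {1..<r} \<and> simple_prod is = w"
  using finite_atLeastAtMost assms
proof (induction rule: permutes_rev_induct)
  case id
  then show ?case by (intro exI[of _ "[]"]) auto
next
  case (swap a b p)
  have "\<exists>js. set js \<subseteq> {1..<r} \<and> simple_prod js = transpose a b"
  proof (cases a b rule: linorder_cases)
    case less
    then show ?thesis
      using transpose_simple_prod[of a "b - Suc a" r] swap by auto
  next
    case equal
    then show ?thesis by (intro exI[of _ "[]"]) auto
  next
    case greater
    then show ?thesis
      using transpose_simple_prod[of b "a - Suc b" r] swap by (auto simp: transpose_commute)
  qed
  then obtain js where "set js \<subseteq> {1..<r}" "simple_prod js = transpose a b" by blast
  moreover obtain "is" where "set is \<subseteq> {1..<r}" "simple_prod is = p"
    using swap by blast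
  ultimately show ?case
    by (intro exI[of _ "is @ js"]) auto
qed

text \<open>Ensures that the choice in \<open>hc_T_perm\<close> really yields a reduced expression:
  take a word of minimal length.\<close>

lemma reduced_expr_exists:
  assumes "w permutes {1..r}"
  shows "\<exists>is. reduced_expr r w is"
proof -
  have "\<exists>is. is_arg_min length (\<lambda>is. set is \<subseteq> {1..<r} \<and> simple_prod is = w) is"
    using permutes_simple_prod[OF assms] by (auto intro: is_arg_min_arg_min_nat)
  then show ?thesis
    by (auto simp: is_arg_min_linorder reduced_expr_def)
qed


section \<open>Computing in the Hecke--Clifford superalgebra\<close>

lemma monom_induct [case_names single add]:
  fixes x :: "'b \<Rightarrow>\<^sub>0 'a::comm_monoid_add"
  assumes "\<And>w a. P (Poly_Mapping.single w a)" and "\<And>x y. P x \<Longrightarrow> P y \<Longrightarrow> P (x + y)"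
  shows "P x"
proof (induction x rule: update_induct)
  case const
  show ?case using assms(1)[of undefined 0] by simp
next
  case (update x w a)
  \<comment> \<open>The key \<open>w\<close> is new, so setting its coefficient amounts to adding a
    monomial.\<close>
  then have "Poly_Mapping.update w a x = x + Poly_Mapping.single w a"
    by (intro poly_mapping_eqI) (auto simp: lookup_update lookup_add lookup_single when_def in_keys_iff)
  with update assms show ?case by metis
qed

lemma carrier_hc_free:
  "carrier (hc_free TYPE('a::comm_ring_1) r) =
     {f. \<forall>w \<in> Poly_Mapping.keys f. set (letters w) \<subseteq> hc_gens r}"
  by (simp add: hc_free_def free_algebra_def)

lemma hc_free_ops [simp]:
  "monoid.mult (hc_free TYPE('a::comm_ring_1) r) = (*)"
  "add (hc_free TYPE('a) r) = (+)"
  "one (hc_free TYPE('a) r) = 1"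
  "zero (hc_free TYPE('a) r) = 0"
  by (simp_all add: hc_free_def free_algebra_def)

lemma ring_hc_free: "ring (hc_free TYPE('a::comm_ring_1) r)"
  unfolding hc_free_def by (rule ring_free_algebra)

lemma uminus_hc_free:
  assumes "x \<in> carrier (hc_free TYPE('a::comm_ring_1) r)"
  shows "- x \<in> carrier (hc_free TYPE('a) r)" "\<ominus>\<^bsub>hc_free TYPE('a) r\<^esub> x = - x"
proof -
  interpret F: ring "hc_free TYPE('a) r" by (rule ring_hc_free)
  show "- x \<in> carrier (hc_free TYPE('a) r)"
    using assms by (simp add: carrier_hc_free)
  with assms show "\<ominus>\<^bsub>hc_free TYPE('a) r\<^esub> x = - x"
    by (metis F.minus_equality hc_free_ops(2,4) left_minus)
qed

lemma minus_hc_free: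
  assumes "x \<in> carrier (hc_free TYPE('a::comm_ring_1) r)" "y \<in> carrier (hc_free TYPE('a) r)"
  shows "x - y \<in> carrier (hc_free TYPE('a) r)" "x \<ominus>\<^bsub>hc_free TYPE('a) r\<^esub> y = x - y"
proof -
  interpret F: ring "hc_free TYPE('a) r" by (rule ring_hc_free)
  show "x \<ominus>\<^bsub>hc_free TYPE('a) r\<^esub> y = x - y"
    using assms by (simp add: a_minus_def uminus_hc_free)
  then show "x - y \<in> carrier (hc_free TYPE('a) r)"
    using assms by (metis F.minus_closed)
qed

lemma hc_free_closed:
  "x \<in> carrier (hc_free TYPE('a::comm_ring_1) r) \<Longrightarrow> y \<in> carrier (hc_free TYPE('a) r) \<Longrightarrow>
     x * y \<in> carrier (hc_free TYPE('a) r)"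
  "x \<in> carrier (hc_free TYPE('a) r) \<Longrightarrow> y \<in> carrier (hc_free TYPE('a) r) \<Longrightarrow>
     x + y \<in> carrier (hc_free TYPE('a) r)"
  "1 \<in> carrier (hc_free TYPE('a) r)"
  "fscal a \<in> carrier (hc_free TYPE('a) r)"
  "i \<in> {1..<r} \<Longrightarrow> fgen (Hk i) \<in> carrier (hc_free TYPE('a) r)"
  "j \<in> {1..r} \<Longrightarrow> fgen (Cl j) \<in> carrier (hc_free TYPE('a) r)"
proof -
  interpret F: ring "hc_free TYPE('a) r" by (rule ring_hc_free)
  show "x \<in> carrier (hc_free TYPE('a::comm_ring_1) r) \<Longrightarrow> y \<in> carrier (hc_free TYPE('a) r) \<Longrightarrow>
     x * y \<in> carrier (hc_free TYPE('a) r)"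
    using F.m_closed by simp
  show "x \<in> carrier (hc_free TYPE('a) r) \<Longrightarrow> y \<in> carrier (hc_free TYPE('a) r) \<Longrightarrow>
     x + y \<in> carrier (hc_free TYPE('a) r)"
    using F.a_closed by simp
  show "1 \<in> carrier (hc_free TYPE('a) r)"
    using F.one_closed by simp
qed (auto simp: carrier_hc_free fscal_def fgen_def hc_gens_def zero_fword_def)

lemma hc_rels_carrier:
  fixes q :: "'a::comm_ring_1"
  shows "hc_rels r q \<subseteq> carrier (hc_free TYPE('a) r)"
  unfolding hc_rels_def Let_def
  by (intro Un_least; clarify; intro minus_hc_free(1) uminus_hc_free(1) hc_free_closed; simp)

lemma ideal_hc_ideal:
  fixes q :: "'a::comm_ring_1"
  shows "ideal (hc_ideal r q) (hc_free TYPE('a) r)"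
  unfolding hc_ideal_def by (intro ring.genideal_ideal ring_hc_free hc_rels_carrier)

lemma ring_hecke_clifford: "ring (hecke_clifford r q)"
  unfolding hecke_clifford_def by (rule ideal.quotient_is_ring[OF ideal_hc_ideal])

text \<open>The projection onto the quotient. Writing \<open>hc_T\<close> and \<open>hc_c\<close> as
  its values turns equations in the algebra into membership in \<open>hc_ideal\<close>.\<close>

definition hc_class :: "nat \<Rightarrow> 'a::comm_ring_1 \<Rightarrow> (hc_gen fword \<Rightarrow>\<^sub>0 'a) \<Rightarrow> (hc_gen fword \<Rightarrow>\<^sub>0 'a) set" where
  "hc_class r q x = hc_ideal r q +>\<^bsub>hc_free TYPE('a) r\<^esub> x"

lemma hc_class_closed:
  fixes q :: "'a::comm_ring_1"
  shows
  "x \<in> carrier (hc_free TYPE('a) r) \<Longrightarrow> hc_class r q x \<in> carrier (hecke_clifford r q)"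
  using ring_hom_closed[OF ideal.rcos_ring_hom[OF ideal_hc_ideal]]
  unfolding hc_class_def hecke_clifford_def .

lemma hc_class_mult:
  fixes q :: "'a::comm_ring_1"
  shows
  "x \<in> carrier (hc_free TYPE('a) r) \<Longrightarrow> y \<in> carrier (hc_free TYPE('a) r) \<Longrightarrow>
     hc_class r q x \<otimes>\<^bsub>hecke_clifford r q\<^esub> hc_class r q y = hc_class r q (x * y)"
  using ring_hom_mult[OF ideal.rcos_ring_hom[OF ideal_hc_ideal], of x r y q]
  unfolding hc_class_def hecke_clifford_def by simp

lemma hc_class_one: "\<one>\<^bsub>hecke_clifford r q\<^esub> = hc_class r q 1"
  using ring_hom_one[OF ideal.rcos_ring_hom[OF ideal_hc_ideal], of r q]
  unfolding hc_class_def hecke_clifford_def by simp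

lemma hc_class_eq_iff:
  assumes "x \<in> carrier (hc_free TYPE('a::comm_ring_1) r)" "y \<in> carrier (hc_free TYPE('a) r)"
  shows "hc_class r q x = hc_class r q y \<longleftrightarrow> x - y \<in> hc_ideal r (q :: 'a)"
  using ring.quotient_eq_iff_same_a_r_cos[OF ring_hc_free ideal_hc_ideal assms, of q] assms
  by (simp add: hc_class_def minus_hc_free)

lemma hc_class_eq_of_rel:
  assumes "x \<in> carrier (hc_free TYPE('a::comm_ring_1) r)" "y \<in> carrier (hc_free TYPE('a) r)"
    and "x - y \<in> hc_rels r (q :: 'a)"
  shows "hc_class r q x = hc_class r q y"
  using assms(3) ring.genideal_self[OF ring_hc_free hc_rels_carrier, of r q]
  by (auto simp: hc_class_eq_iff[OF assms(1,2)] hc_ideal_def)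

lemma hc_T_eq_class: "hc_T r q i = hc_class r q (fgen (Hk i))"
  by (simp add: hc_T_def hc_class_def)

lemma hc_c_eq_class: "hc_c r q i = hc_class r q (fgen (Cl i))"
  by (simp add: hc_c_def hc_class_def)

text \<open>A lift of \<open>hc_T_word\<close> to the free algebra, which is what acts on the module
  below.\<close>

definition T_monom :: "nat list \<Rightarrow> hc_gen fword \<Rightarrow>\<^sub>0 'a::comm_ring_1" where
  "T_monom is = prod_list (map (\<lambda>i. fgen (Hk i)) is)"

lemma T_monom_closed: "set is \<subseteq> {1..<r} \<Longrightarrow> T_monom is \<in> carrier (hc_free TYPE('a::comm_ring_1) r)"
  by (induction "is") (auto simp: T_monom_def intro!: hc_free_closed)

lemma hc_T_word_eq_class:
  fixes q :: "'a::comm_ring_1"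
  shows "set is \<subseteq> {1..<r} \<Longrightarrow> hc_T_word r q is = hc_class r q (T_monom is)"
proof (induction "is")
  case Nil
  show ?case by (simp add: hc_T_word_def T_monom_def hc_class_one)
next
  case (Cons i "is")
  then show ?case
    using hc_class_mult[OF hc_free_closed(5) T_monom_closed, of i r "is" q]
    by (simp add: hc_T_word_def T_monom_def hc_T_eq_class)
qed

text \<open>The excluded index \<open>i + 1\<close> is the one whose relation carries the extra term
  $(q-1)(c_i - c_{i+1})$.\<close>

lemma hc_c_T:
  fixes q :: "'a::comm_ring_1"
  assumes i: "i \<in> {1..<r}" and j: "j \<in> {1..r}" "j \<noteq> i + 1"
  shows "hc_c r q (transpose i (i + 1) j) \<otimes>\<^bsub>hecke_clifford r q\<^esub> hc_T r q i
       = hc_T r q i \<otimes>\<^bsub>hecke_clifford r q\<^esub> hc_c r q j"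
proof -
  have t: "transpose i (i + 1) j \<in> {1..r}"
    using i j by (auto simp: transpose_def)
  have "fgen (Cl (transpose i (i + 1) j)) * fgen (Hk i) - fgen (Hk i) * fgen (Cl j) \<in> hc_rels r q"
  proof (cases "j = i")
    case True
    then show ?thesis using i unfolding hc_rels_def Let_def by auto
  next
    case False
    with j have "transpose i (i + 1) j = j" by (simp add: transpose_def)
    with False i j show ?thesis unfolding hc_rels_def Let_def by auto
  qed
  then show ?thesis
    using i j t unfolding hc_c_eq_class hc_T_eq_class
    by (simp only: hc_class_mult hc_free_closed hc_class_eq_of_rel)
qed

lemma simple_prod_mem: "set is \<subseteq> {1..<r} \<Longrightarrow> j \<in> {1..r} \<Longrightarrow> simple_prod is j \<in> {1..r}"
  by (induction "is") (auto simp: transpose_def)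

text \<open>Induction on the last letter $i$: first move $c_j$ past $T_i$ by \<open>hc_c_T\<close>,
  then apply the induction hypothesis at position $s_i(j)$, where the absence of inversions has to
  be checked again.\<close>

lemma hc_c_T_word_commute:
  fixes q :: "'a::comm_ring_1"
  assumes "increasing_word is" "set is \<subseteq> {1..<r}" "j \<in> {1..r}"
    and "\<And>a. a < j \<Longrightarrow> simple_prod is a < simple_prod is j"
  shows "hc_c r q (simple_prod is j) \<otimes>\<^bsub>hecke_clifford r q\<^esub> hc_T_word r q is
       = hc_T_word r q is \<otimes>\<^bsub>hecke_clifford r q\<^esub> hc_c r q j"
  using assms
proof (induction arbitrary: j rule: increasing_word.induct)
  case increasing_Nil
  interpret H: ring "hecke_clifford r q" by (rule ring_hecke_clifford)
  from increasing_Nil show ?case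
    by (simp add: hc_T_word_def hc_c_eq_class hc_class_closed hc_free_closed)
next
  case (increasing_snoc "is" i)
  interpret H: ring "hecke_clifford r q" by (rule ring_hecke_clifford)
  let ?j = "transpose i (i + 1) j"
  from increasing_snoc.prems have i: "i \<in> {1..<r}" and sub: "set is \<subseteq> {1..<r}" by auto
  have prod: "simple_prod (is @ [i]) a = simple_prod is (transpose i (i + 1) a)" for a by simp
  \<comment> \<open>As \<open>is\<close> ascends at \<open>i\<close>, the longer word has a larger
    value at \<open>i\<close> than at \<open>i + 1\<close>, an inversion that the hypothesis forbids
    for \<open>j = i + 1\<close>.\<close>
  have ne: "j \<noteq> i + 1"
    using increasing_snoc.prems(3)[of i] increasing_snoc.hyps(2) by (auto simp: prod)
  have j: "?j \<in> {1..r}"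
    using i increasing_snoc.prems by (auto simp: transpose_def)
  \<comment> \<open>For \<open>j = i\<close> the position moves up to \<open>i + 1\<close>, and the
    newly preceding position \<open>i\<close> is settled by the ascent. All other positions before
    \<open>?j\<close> come from positions before \<open>j\<close>.\<close>
  have less: "simple_prod is a < simple_prod is ?j" if "a < ?j" for a
  proof (cases "j = i \<and> a = i")
    case True
    then show ?thesis using increasing_snoc.hyps(2) by simp
  next
    case False
    then have "transpose i (i + 1) a < j"
      using that ne by (auto simp: transpose_def split: if_splits)
    from increasing_snoc.prems(3)[OF this] show ?thesis by (simp add: prod)
  qed
  have word: "hc_T_word r q (is @ [i]) = hc_T_word r q is \<otimes>\<^bsub>hecke_clifford r q\<^esub> hc_T r q i"
    using i sub hc_class_mult[OF T_monom_closed[OF sub] hc_free_closed(5)[OF i], of q]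
    by (simp add: hc_T_word_eq_class hc_T_eq_class T_monom_def)
  have closed: "hc_T_word r q is \<in> carrier (hecke_clifford r q)"
    "hc_T r q i \<in> carrier (hecke_clifford r q)"
    "\<And>l. l \<in> {1..r} \<Longrightarrow> hc_c r q l \<in> carrier (hecke_clifford r q)"
    using i sub by (simp_all add: hc_T_word_eq_class hc_T_eq_class hc_c_eq_class
      hc_class_closed T_monom_closed hc_free_closed)
  show ?case
  proof -
    let ?c = "hc_c r q" and ?W = "hc_T_word r q is" and ?T = "hc_T r q i"
    have w: "simple_prod is ?j \<in> {1..r}" using sub j
      by (rule simple_prod_mem)
    have "?c (simple_prod (is @ [i]) j) \<otimes>\<^bsub>hecke_clifford r q\<^esub> hc_T_word r q (is @ [i])
        = (?c (simple_prod is ?j) \<otimes>\<^bsub>hecke_clifford r q\<^esub> ?W) \<otimes>\<^bsub>hecke_clifford r q\<^esub> ?T"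
      unfolding word prod using w by (simp only: H.m_assoc closed)
    also have "\<dots> = (?W \<otimes>\<^bsub>hecke_clifford r q\<^esub> ?c ?j) \<otimes>\<^bsub>hecke_clifford r q\<^esub> ?T"
      by (simp only: increasing_snoc.IH[OF sub j less])
    also have "\<dots> = ?W \<otimes>\<^bsub>hecke_clifford r q\<^esub> (?T \<otimes>\<^bsub>hecke_clifford r q\<^esub> ?c j)"
      using j hc_c_T[OF i increasing_snoc.prems(2) ne, of q] by (simp only: H.m_assoc closed)
    also have "\<dots> = hc_T_word r q (is @ [i]) \<otimes>\<^bsub>hecke_clifford r q\<^esub> ?c j"
      unfolding word using increasing_snoc.prems(2) by (simp only: H.m_assoc closed)
    finally show ?thesis .
  qed
qed


section \<open>The induced Clifford module\<close>

text \<open>The sign from moving $c_i$ past the factors with smaller index in an ascending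
  product.\<close>

definition sgn_below :: "(nat \<Rightarrow> bool) \<Rightarrow> nat \<Rightarrow> 'a::comm_ring_1" where
  "sgn_below s i = (\<Prod>a<i. if s a then - 1 else 1)"

text \<open>A function \<open>f\<close> stands for the formal sum of \<open>f s\<close> times the product of the $c_a$ with \<open>s a\<close> in
  ascending order. The formulas are obtained by evaluating the left action of the generators on such
  products, where $T_i$ acts on the empty product by \<open>q\<close>.\<close>

fun gen_act :: "'a::comm_ring_1 \<Rightarrow> hc_gen \<Rightarrow> ((nat \<Rightarrow> bool) \<Rightarrow> 'a) \<Rightarrow> (nat \<Rightarrow> bool) \<Rightarrow> 'a" where
  "gen_act q (Hk i) f s =
     (if s i then if s (Suc i) then - f s else f (s(i := False, Suc i := True))
      else if s (Suc i) then q * f (s(i := True, Suc i := False)) + (q - 1) * f s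
      else q * f s - (q - 1) * f (s(i := True, Suc i := True)))"
| "gen_act q (Cl i) f s =
     sgn_below s i * (if s i then f (s(i := False)) else - f (s(i := True)))"

declare gen_act.simps [simp del]

lemma sgn_below_upd:
  "sgn_below (s(j := b)) i = (if j < i \<and> s j \<noteq> b then - sgn_below s i else sgn_below s i)"
proof (cases "j < i")
  case True
  then have *: "{..<i} = insert j ({..<i} - {j})" by auto
  show ?thesis
    unfolding sgn_below_def by (subst (1 2 3) *, subst (1 2 3) prod.insert) (use True in \<open>auto intro!: prod.cong\<close>)
next
  case False
  then show ?thesis by (auto simp: sgn_below_def intro!: prod.cong)
qed

lemma sgn_below_sq: "sgn_below s i * sgn_below s i = 1"
  unfolding sgn_below_def prod.distrib[symmetric] by (rule prod.neutral) auto

lemma sgn_below_Suc: "sgn_below s (Suc i) = (if s i then - sgn_below s i else sgn_below s i)"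
  by (simp add: sgn_below_def)

lemma sgn_below_sq2: "sgn_below s i * (sgn_below s i * x) = x"
  by (metis mult.assoc mult_1 sgn_below_sq)

lemmas gen_act_rules = gen_act.simps sgn_below_upd

section \<open>The defining relations on the module\<close>

lemma gen_act_Cl_square: "gen_act q (Cl i) (gen_act q (Cl i) f) s = - f s"
  by (auto simp: gen_act_rules sgn_below_sq2 fun_upd_idem)

lemma gen_act_Cl_anticommute:
  "i \<noteq> j \<Longrightarrow> gen_act q (Cl i) (gen_act q (Cl j) f) s = - gen_act q (Cl j) (gen_act q (Cl i) f) s"
  by (auto simp: gen_act_rules fun_upd_twist)

lemma gen_act_Hk_quadratic:
  "gen_act q (Hk i) (gen_act q (Hk i) f) s = (q - 1) * gen_act q (Hk i) f s + q * f s"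
  by (auto simp: gen_act_rules fun_upd_twist fun_upd_idem algebra_simps)

lemma gen_act_Hk_commute:
  "Suc i < j \<Longrightarrow> gen_act q (Hk i) (gen_act q (Hk j) f) s = gen_act q (Hk j) (gen_act q (Hk i) f) s"
  by (auto simp: gen_act_rules fun_upd_twist algebra_simps)

lemma gen_act_Hk_braid:
  "gen_act q (Hk i) (gen_act q (Hk (Suc i)) (gen_act q (Hk i) f)) s =
    gen_act q (Hk (Suc i)) (gen_act q (Hk i) (gen_act q (Hk (Suc i)) f)) s"
proof -
  \<comment> \<open>Only three neighbouring positions matter. Writing \<open>s\<close> as an update
    of itself there makes each of the eight cases a computation with explicit truth values.\<close>
  define s0 where "s0 = s"
  define x y z where "x = s i" "y = s (Suc i)" "z = s (Suc (Suc i))"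
  have s: "s = s0(i := x, Suc i := y, Suc (Suc i) := z)"
    by (auto simp: x_y_z_def s0_def)
  show ?thesis
    unfolding s by (cases x; cases y; cases z; simp add: gen_act_rules fun_upd_twist; simp add: algebra_simps)
qed

lemma gen_act_Cl_Hk_far:
  assumes "i \<noteq> j" "j \<noteq> Suc i"
  shows "gen_act q (Cl j) (gen_act q (Hk i) f) s = gen_act q (Hk i) (gen_act q (Cl j) f) s"
  using assms by (auto simp: gen_act_rules fun_upd_twist algebra_simps)

lemma gen_act_Cl_Suc_Hk:
  "gen_act q (Cl (Suc i)) (gen_act q (Hk i) f) s = gen_act q (Hk i) (gen_act q (Cl i) f) s"
  by (auto simp: gen_act_rules fun_upd_twist fun_upd_idem algebra_simps sgn_below_Suc)

lemma gen_act_Cl_Hk: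
  "gen_act q (Cl i) (gen_act q (Hk i) f) s = gen_act q (Hk i) (gen_act q (Cl (Suc i)) f) s
    + (q - 1) * (gen_act q (Cl i) f s - gen_act q (Cl (Suc i)) f s)"
  by (auto simp: gen_act_rules fun_upd_twist fun_upd_idem algebra_simps sgn_below_Suc)

section \<open>The action of the free algebra and its descent to the quotient\<close>

definition word_act :: "'a::comm_ring_1 \<Rightarrow> hc_gen fword \<Rightarrow> ((nat \<Rightarrow> bool) \<Rightarrow> 'a) \<Rightarrow> (nat \<Rightarrow> bool) \<Rightarrow> 'a" where
  "word_act q w = foldr (gen_act q) (letters w)"

definition alg_act :: "'a::comm_ring_1 \<Rightarrow> (hc_gen fword \<Rightarrow>\<^sub>0 'a) \<Rightarrow> ((nat \<Rightarrow> bool) \<Rightarrow> 'a) \<Rightarrow> (nat \<Rightarrow> bool) \<Rightarrow> 'a" where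
  "alg_act q x f s = (\<Sum>w \<in> Poly_Mapping.keys x. Poly_Mapping.lookup x w * word_act q w f s)"

lemma gen_act_linear: "gen_act q g (\<lambda>s. a * f s + f' s) = (\<lambda>s. a * gen_act q g f s + gen_act q g f' s)"
  by (cases g) (auto simp: gen_act.simps fun_eq_iff algebra_simps)

lemma word_act_linear: "word_act q w (\<lambda>s. a * f s + f' s) = (\<lambda>s. a * word_act q w f s + word_act q w f' s)"
proof -
  have "foldr (gen_act q) gs (\<lambda>s. a * f s + f' s) =
      (\<lambda>s. a * foldr (gen_act q) gs f s + foldr (gen_act q) gs f' s)" for gs
    by (induction gs) (simp_all add: gen_act_linear)
  then show ?thesis by (simp add: word_act_def)
qed

lemma word_act_plus: "word_act q (u + v) f = word_act q u (word_act q v f)"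
  by (simp add: word_act_def plus_fword_def)

lemma alg_act_add: "alg_act q (x + y) f s = alg_act q x f s + alg_act q y f s"
proof -
  let ?K = "Poly_Mapping.keys x \<union> Poly_Mapping.keys y"
  have *: "alg_act q z f s = (\<Sum>w \<in> ?K. Poly_Mapping.lookup z w * word_act q w f s)"
    if "Poly_Mapping.keys z \<subseteq> ?K" for z
    unfolding alg_act_def by (rule sum.mono_neutral_left) (use that in \<open>auto simp: in_keys_iff\<close>)
  show ?thesis
    by (simp add: * keys_add lookup_add distrib_right sum.distrib)
qed

lemma alg_act_single: "alg_act q (Poly_Mapping.single w a) f s = a * word_act q w f s"
  by (simp add: alg_act_def)

lemma alg_act_linear: "alg_act q x (\<lambda>s. a * f s + f' s) = (\<lambda>s. a * alg_act q x f s + alg_act q x f' s)"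
  by (simp add: fun_eq_iff alg_act_def word_act_linear distrib_left sum.distrib sum_distrib_left mult.left_commute)

lemma alg_act_zero_fun: "alg_act q x (\<lambda>s. 0) = (\<lambda>s. 0)"
  \<comment> \<open>With factor $-1$ and both functions zero, linearity says that the image of 0 is
    minus itself plus itself.\<close>
  using alg_act_linear[of q x "- 1" "\<lambda>s. 0" "\<lambda>s. 0"] by simp

text \<open>By additivity in both factors it suffices to compare monomials, where concatenation of
  words is composition of actions. Additivity in \<open>y\<close> rests on the linearity of the
  action of \<open>x\<close>.\<close>

lemma alg_act_mult: "alg_act q (x * y) f = alg_act q x (alg_act q y f)"
proof (induction x rule: monom_induct)
  case (single u a)
  show ?case
  proof (induction y rule: monom_induct)
    case (single v b)
    \<comment> \<open>Linearity with second summand 0. The action of the monomial \<open>u\<close>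
      with coefficient 1 shows that \<open>word_act q u\<close> kills the zero function.\<close>
    have "word_act q u (\<lambda>s. b * word_act q v f s) = (\<lambda>s. b * word_act q (u + v) f s)"
      using word_act_linear[of q u b "word_act q v f" "\<lambda>s. 0"] alg_act_zero_fun[of q "Poly_Mapping.single u 1"]
      by (simp add: word_act_plus fun_eq_iff alg_act_single)
    then show ?case
      by (simp add: mult_single alg_act_single fun_eq_iff mult.assoc)
  next
    case (add y z)
    have "alg_act q (y + z) f = (\<lambda>s. 1 * alg_act q y f s + alg_act q z f s)"
      by (simp add: alg_act_add fun_eq_iff)
    then show ?case
      using add by (simp only: distrib_left alg_act_linear) (simp add: alg_act_add fun_eq_iff)
  qed
next
  case (add x y)
  then show ?case by (simp add: distrib_right alg_act_add fun_eq_iff)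
qed

lemma alg_act_simps:
  "alg_act q (x * y) f s = alg_act q x (alg_act q y f) s"
  "alg_act q (x + y) f s = alg_act q x f s + alg_act q y f s"
  "alg_act q (- x) f s = - alg_act q x f s"
  "alg_act q (x - y) f s = alg_act q x f s - alg_act q y f s"
  "alg_act q (fscal a) f s = a * f s"
  "alg_act q 1 f s = f s"
  "alg_act q 0 f s = 0"
  "alg_act q (fgen g) = gen_act q g"
proof -
  show zero: "alg_act q 0 f s = 0" by (simp add: alg_act_def)
  show uminus: "alg_act q (- x) f s = - alg_act q x f s" for x
    using alg_act_add[of q x "- x" f s] zero by (simp add: eq_neg_iff_add_eq_0 add.commute)
  show "alg_act q (x - y) f s = alg_act q x f s - alg_act q y f s"
    using alg_act_add[of q x "- y" f s] uminus[of y] by simp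
  show "alg_act q (fgen g) = gen_act q g"
    by (simp add: fgen_def alg_act_single word_act_def fun_eq_iff)
  have "fscal 1 = (1 :: hc_gen fword \<Rightarrow>\<^sub>0 'a)"
    by (simp add: fscal_def)
  moreover show scal: "alg_act q (fscal a) f s = a * f s" for a
    by (simp add: fscal_def alg_act_single word_act_def zero_fword_def)
  ultimately show "alg_act q 1 f s = f s" by (metis mult_1)
qed (simp_all add: alg_act_mult alg_act_add)

lemma alg_act_rels:
  fixes q :: "'a::comm_ring_1"
  assumes "x \<in> hc_rels r q"
  shows "alg_act q x f = (\<lambda>s. 0)"
proof
  fix s
  from assms consider
      (cc) i where "x = fgen (Cl i) * fgen (Cl i) - fscal (- 1)"
    | (cicj) i j where "x = fgen (Cl i) * fgen (Cl j) - (- (fgen (Cl j) * fgen (Cl i)))" "i \<noteq> j"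
    | (tt) i where "x = (fgen (Hk i) - fscal q) * (fgen (Hk i) + 1)"
    | (titj) i j where "x = fgen (Hk i) * fgen (Hk j) - fgen (Hk j) * fgen (Hk i)" "\<bar>int i - int j\<bar> > 1"
    | (braid) i where "x = fgen (Hk i) * fgen (Hk (i + 1)) * fgen (Hk i)
          - fgen (Hk (i + 1)) * fgen (Hk i) * fgen (Hk (i + 1))"
    | (ct) i j where "x = fgen (Cl j) * fgen (Hk i) - fgen (Hk i) * fgen (Cl j)" "j \<noteq> i" "j \<noteq> i + 1"
    | (cSt) i where "x = fgen (Cl (i + 1)) * fgen (Hk i) - fgen (Hk i) * fgen (Cl i)"
    | (cit) i where "x = fgen (Cl i) * fgen (Hk i) -
        (fgen (Hk i) * fgen (Cl (i + 1)) + fscal (q - 1) * (fgen (Cl i) - fgen (Cl (i + 1))))"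
    unfolding hc_rels_def Let_def by (elim UnE CollectE exE conjE) (rule that; assumption)+
  then show "alg_act q x f s = 0"
  proof cases
    case cc
    then show ?thesis by (simp only: alg_act_simps gen_act_Cl_square) simp
  next
    case cicj
    then show ?thesis by (simp only: alg_act_simps gen_act_Cl_anticommute[OF cicj(2)]) simp
  next
    case tt
    \<comment> \<open>The factor 1 brings this into the shape of
      \<open>gen_act_linear\<close>.\<close>
    have "alg_act q (fgen (Hk i) + 1) f = (\<lambda>s. 1 * gen_act q (Hk i) f s + f s)"
      by (simp add: alg_act_simps fun_eq_iff)
    then show ?thesis
      by (simp only: tt alg_act_simps(1,4,5,8) gen_act_linear gen_act_Hk_quadratic) (simp add: algebra_simps)
  next
    case titj
    then have "Suc i < j \<or> Suc j < i" by linarith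
    with gen_act_Hk_commute[of i j q f s] gen_act_Hk_commute[of j i q f s] titj show ?thesis
      by (auto simp: alg_act_simps)
  next
    case braid
    then show ?thesis by (simp add: alg_act_simps gen_act_Hk_braid)
  next
    case ct
    then show ?thesis using gen_act_Cl_Hk_far[of i j q f s] by (simp add: alg_act_simps)
  next
    case cSt
    then show ?thesis by (simp add: alg_act_simps gen_act_Cl_Suc_Hk)
  next
    case cit
    then show ?thesis by (simp add: alg_act_simps gen_act_Cl_Hk)
  qed
qed

text \<open>The annihilator of the module is an ideal containing the relations, hence contains the
  ideal that they generate.\<close>

lemma alg_act_ideal:
  fixes q :: "'a::comm_ring_1"
  assumes "x \<in> hc_ideal r q"
  shows "alg_act q x f = (\<lambda>s. 0)"
proof -
  interpret F: ring "hc_free TYPE('a) r" by (rule ring_hc_free)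
  let ?K = "{x \<in> carrier (hc_free TYPE('a) r). \<forall>f. alg_act q x f = (\<lambda>s. 0)}"
  have "ideal ?K (hc_free TYPE('a) r)"
  proof (rule idealI)
    show "subgroup ?K (add_monoid (hc_free TYPE('a) r))"
    proof (rule F.add.subgroupI)
      have "0 \<in> ?K"
        using F.zero_closed by (simp add: alg_act_simps fun_eq_iff)
      then show "?K \<noteq> {}" by blast
    qed (auto simp: uminus_hc_free hc_free_closed alg_act_simps fun_eq_iff simp flip: a_inv_def)
  qed (auto simp: ring_hc_free hc_free_closed alg_act_mult alg_act_zero_fun)
  moreover have "hc_rels r q \<subseteq> ?K"
    using hc_rels_carrier alg_act_rels by blast
  ultimately have "hc_ideal r q \<subseteq> ?K"
    unfolding hc_ideal_def by (rule F.genideal_minimal)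
  with assms show ?thesis by blast
qed

section \<open>The empty product \<open>vacuum\<close> and the vectors $T_w c_j$ applied to
  it\<close>

definition vacuum :: "(nat \<Rightarrow> bool) \<Rightarrow> 'a::comm_ring_1" where
  "vacuum s = (if s = (\<lambda>_. False) then 1 else 0)"

lemma vacuum_eq_0: "s a \<Longrightarrow> vacuum s = 0"
  by (auto simp: vacuum_def)

lemma T_vacuum:
  fixes q :: "'a::comm_ring_1"
  shows "gen_act q (Hk i) vacuum = (\<lambda>s. q * vacuum s)"
proof
  fix s
  have "vacuum s = (0::'a)" if "s i \<or> s (Suc i)"
    using that vacuum_eq_0 by metis
  moreover
  have "vacuum (s(i := False, Suc i := True)) = (0::'a)" "vacuum (s(i := True, Suc i := b)) = (0::'a)" for b
    by (rule vacuum_eq_0[of _ "Suc i"], simp) (rule vacuum_eq_0[of _ i], simp)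
  ultimately show "gen_act q (Hk i) vacuum s = q * vacuum s"
    by (auto simp: gen_act.simps)
qed

text \<open>The argument \<open>\<lambda>a. a = b\<close> is the index of the basis vector
  $c_b$.\<close>

lemma c_vacuum_coeff: "gen_act q (Cl j) vacuum (\<lambda>a. a = b) = (if j = b then 1 else 0)"
  by (auto simp: gen_act.simps vacuum_def fun_eq_iff sgn_below_def)

definition T_act :: "'a::comm_ring_1 \<Rightarrow> nat list \<Rightarrow> ((nat \<Rightarrow> bool) \<Rightarrow> 'a) \<Rightarrow> (nat \<Rightarrow> bool) \<Rightarrow> 'a" where
  "T_act q is = alg_act q (T_monom is)"

lemma T_act_Nil: "T_act q [] f = f"
  by (simp add: T_act_def T_monom_def fun_eq_iff alg_act_simps)

lemma T_act_snoc: "T_act q (is @ [i]) f = T_act q is (gen_act q (Hk i) f)"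
  by (simp add: T_act_def T_monom_def fun_eq_iff alg_act_simps)

lemma alg_act_scale: "alg_act q x (\<lambda>s. a * f s) = (\<lambda>s. a * alg_act q x f s)"
  using alg_act_linear[of q x a f "\<lambda>s. 0"] by (simp add: alg_act_zero_fun)

lemma T_act_vacuum: "T_act q is vacuum = (\<lambda>s. q ^ length is * vacuum s)"
proof (induction "is" rule: rev_induct)
  case Nil
  show ?case by (simp add: T_act_Nil)
next
  case (snoc i "is")
  then show ?case
    by (simp add: T_act_snoc T_vacuum) (simp add: T_act_def alg_act_scale mult.assoc)
qed

lemma gen_act_scale: "gen_act q g (\<lambda>s. a * f s) = (\<lambda>s. a * gen_act q g f s)"
  using alg_act_scale[of q "fgen g" a f] by (simp add: alg_act_simps)

text \<open>Solve the mixed relations for $T_i c_j$ and use $T_i 1 = q$. In the last formula $q c_i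
  - (q-1) c_i$ leaves $c_i$.\<close>

lemma T_c_vacuum:
  fixes q :: "'a::comm_ring_1"
  defines "e \<equiv> \<lambda>j. gen_act q (Cl j) vacuum"
  shows "j \<noteq> i \<Longrightarrow> j \<noteq> Suc i \<Longrightarrow> gen_act q (Hk i) (e j) = (\<lambda>s. q * e j s)"
    and "gen_act q (Hk i) (e i) = (\<lambda>s. q * e (Suc i) s)"
    and "gen_act q (Hk i) (e (Suc i)) = (\<lambda>s. (q - 1) * e (Suc i) s + e i s)"
proof -
  show "gen_act q (Hk i) (e j) = (\<lambda>s. q * e j s)" if "j \<noteq> i" "j \<noteq> Suc i"
    using gen_act_Cl_Hk_far[of i j q vacuum] that by (simp add: e_def T_vacuum gen_act_scale fun_eq_iff)
  show "gen_act q (Hk i) (e i) = (\<lambda>s. q * e (Suc i) s)"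
    using gen_act_Cl_Suc_Hk[of q i vacuum] by (simp add: e_def T_vacuum gen_act_scale fun_eq_iff)
  show "gen_act q (Hk i) (e (Suc i)) = (\<lambda>s. (q - 1) * e (Suc i) s + e i s)"
    using gen_act_Cl_Hk[of q i vacuum] by (simp add: e_def T_vacuum gen_act_scale fun_eq_iff algebra_simps)
qed

lemma prefix_max_index:
  fixes w :: "nat \<Rightarrow> nat"
  shows "\<exists>m \<le> j. \<forall>a \<le> j. w a \<le> w m"
proof -
  have "Max (w ` {..j}) \<in> w ` {..j}" by (intro Max_in) auto
  then obtain m where "m \<le> j" "Max (w ` {..j}) = w m" by blast
  moreover from this have "w a \<le> w m" if "a \<le> j" for a
    using that Max_ge[of "w ` {..j}" "w a"] by auto
  ultimately show ?thesis by blast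
qed

text \<open>The parameter \<open>t\<close> is the inverse of \<open>q\<close>, so $q^{\ell} (1 - t)$ is $q^{\ell - 1} (q - 1)$ without the
  truncated subtraction in the exponent.\<close>

lemma T_act_c_vacuum_coeff:
  fixes q :: "'a::comm_ring_1"
  assumes "q * t = 1" and "increasing_word is"
    and "m \<le> j" and "\<And>a. a \<le> j \<Longrightarrow> simple_prod is a \<le> simple_prod is m"
  shows "T_act q is (gen_act q (Cl j) vacuum) (\<lambda>a. a = simple_prod is m) =
      q ^ length is * (if m = j then 1 else 1 - t) \<and>
    (\<forall>b > simple_prod is m. T_act q is (gen_act q (Cl j) vacuum) (\<lambda>a. a = b) = 0)"
  using assms(2-)
proof (induction arbitrary: j m rule: increasing_word.induct)
  case increasing_Nil
  from increasing_Nil(2)[of j] increasing_Nil(1) have "m = j" by simp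
  then show ?case by (simp add: T_act_Nil c_vacuum_coeff)
next
  case (increasing_snoc "is" i)
  let ?w = "simple_prod is" and ?s = "transpose i (i + 1)"
  let ?e = "\<lambda>j. gen_act q (Cl j) vacuum"
  let ?T = "\<lambda>j b. T_act q is (?e j) (\<lambda>a. a = b)"
  have prod: "simple_prod (is @ [i]) a = ?w (?s a)" for a by simp
  have scale: "T_act q is (\<lambda>s. a * f s) = (\<lambda>s. a * T_act q is f s)" for a f
    by (simp add: T_act_def alg_act_scale)
  have max: "?w a \<le> ?w (?s m)" if "?s a \<le> j" for a
    using increasing_snoc.prems(2)[OF that] unfolding prod by simp
  have asc: "?w i < ?w (Suc i)" using increasing_snoc.hyps(2) by simp
  \<comment> \<open>By \<open>T_c_vacuum\<close>, $T_i$ sends $c_j$ to a multiple of a single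
    vector, except for $j = i+1$, where two terms arise.\<close>
  consider (far) "j \<noteq> i" "j \<noteq> Suc i" | (left) "j = i" | (right) "j = Suc i" by blast
  then show ?case
  proof cases
    case far
    have "?s m \<le> j"
      using far increasing_snoc.prems(1) by (auto simp: transpose_def)
    moreover have "?w a \<le> ?w (?s m)" if "a \<le> j" for a
      using far that by (intro max) (auto simp: transpose_def)
    moreover have "?s m = j \<longleftrightarrow> m = j"
      using far by (auto simp: transpose_def)
    ultimately show ?thesis
      using increasing_snoc.IH[of "?s m" j]
      unfolding prod T_act_snoc T_c_vacuum(1)[OF far] scale by (simp add: mult.assoc)
  next
    case left
    have "?s m \<le> Suc i"
      using left increasing_snoc.prems(1) by (auto simp: transpose_def)
    moreover have "?w a \<le> ?w (?s m)" if "a \<le> Suc i" for a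
    \<comment> \<open>Up to \<open>Suc i\<close>, only \<open>i\<close> is not of the form $s_i(b)$
      with $b$ at most $i$. By the ascent its value lies below that at \<open>Suc i\<close>, so the
      maximum is unchanged.\<close>
    proof (cases "a = i")
      case True
      with asc max[of "Suc i"] left show ?thesis by (simp add: transpose_def)
    next
      case False
      with that left show ?thesis by (intro max) (auto simp: transpose_def)
    qed
    moreover have "?s m = Suc i \<longleftrightarrow> m = i"
      by (auto simp: transpose_def)
    ultimately show ?thesis
      using increasing_snoc.IH[of "?s m" "Suc i"]
      unfolding prod T_act_snoc left T_c_vacuum(2) scale by (simp add: mult.assoc)
  next
    case right
    have max': "?w a \<le> ?w (?s m)" if "a \<le> Suc i" for a
      using that right by (intro max) (auto simp: transpose_def)
    \<comment> \<open>After the last letter the larger of the two neighbouring values stands at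
      position \<open>i\<close>.\<close>
    have "m \<noteq> Suc i"
    proof
      assume "m = Suc i"
      with max'[of "Suc i"] asc show False by (simp add: transpose_def)
    qed
    with right increasing_snoc.prems(1) have m: "m \<le> i" by simp
    have T: "T_act q (is @ [i]) (?e (Suc i)) (\<lambda>a. a = b) = (q - 1) * ?T (Suc i) b + ?T i b" for b
      unfolding T_act_snoc T_c_vacuum(3) by (simp add: T_act_def alg_act_linear)
    have "?s m \<le> Suc i" using m by (auto simp: transpose_def)
    note IH = increasing_snoc.IH[OF this max']
    have q1: "q * (1 - t) = q - 1" using assms(1) by (simp add: algebra_simps)
    show ?thesis
    proof (cases "m = i")
      case True
      \<comment> \<open>Now \<open>?w\<close> has its maximum up to \<open>Suc i\<close> at
        \<open>Suc i\<close> itself. The term of $c_{i+1}$ contributes $(q-1) q^l$, with $l$ the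
        length of \<open>is\<close>. The term of $c_i$ contributes nothing, since the maximum up to
        \<open>i\<close> is smaller; this is where the vanishing above the maximum enters.\<close>
      then have sm: "?s m = Suc i" by simp
      obtain m' where m': "m' \<le> i" "\<And>a. a \<le> i \<Longrightarrow> ?w a \<le> ?w m'"
        using prefix_max_index[of i ?w] by blast
      have zero: "?T i b = 0" if "?w m' < b" for b
        using increasing_snoc.IH[OF m'] that by blast
      have less: "?w m' < ?w (Suc i)"
        using max'[of m'] m'(1) unfolding sm by (simp add: le_less)
      show ?thesis
        unfolding right T prod using IH True q1 less zero unfolding sm
        by (auto simp flip: q1 simp: mult_ac)
    next
      case False
      with m have sm: "?s m = m" by (simp add: transpose_def)
      have "?w a \<le> ?w m" if "a \<le> i" for a
        using max'[of a] that sm by simp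
      note IH' = increasing_snoc.IH[OF m this]
      \<comment> \<open>The maximum lies before \<open>i\<close>, so both terms have the same
        coefficient, and the factors $q-1$ and 1 add up to $q$.\<close>
      have "(q - 1) * (q ^ length is * (1 - t)) + q ^ length is * (1 - t) = q ^ length (is @ [i]) * (1 - t)"
        by (simp add: algebra_simps)
      then show ?thesis
        unfolding right T prod using IH IH' m False unfolding sm by auto
    qed
  qed
qed

lemma hc_c_T_perm_commute_iff:
  fixes q :: "'a::comm_ring_1"
  assumes "q dvd 1" "q \<noteq> 1" "w permutes {1..r}" "j \<in> {1..r}"
  shows "hc_c r q (w j) \<otimes>\<^bsub>hecke_clifford r q\<^esub> hc_T_perm r q w =
      hc_T_perm r q w \<otimes>\<^bsub>hecke_clifford r q\<^esub> hc_c r q j \<longleftrightarrow> (\<forall>a < j. w a < w j)"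
proof -
  define ws where "ws = (SOME is. reduced_expr r w is)"
  have red: "reduced_expr r w ws"
    unfolding ws_def by (rule someI_ex[OF reduced_expr_exists[OF assms(3)]])
  then have ws: "set ws \<subseteq> {1..<r}" and w: "w = simple_prod ws"
    by (auto simp: reduced_expr_def)
  have inc: "increasing_word ws" by (rule reduced_expr_increasing[OF red])
  have T: "hc_T_perm r q w = hc_T_word r q ws"
    by (simp add: hc_T_perm_def ws_def)
  have wj: "w j \<in> {1..r}" using permutes_in_image[OF assms(3)] assms(4) by blast
  show ?thesis
  proof
    assume "\<forall>a < j. w a < w j"
    then show "hc_c r q (w j) \<otimes>\<^bsub>hecke_clifford r q\<^esub> hc_T_perm r q w =
      hc_T_perm r q w \<otimes>\<^bsub>hecke_clifford r q\<^esub> hc_c r q j"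
      unfolding T unfolding w by (intro hc_c_T_word_commute[OF inc ws assms(4)]) blast
  next
    assume "hc_c r q (w j) \<otimes>\<^bsub>hecke_clifford r q\<^esub> hc_T_perm r q w =
      hc_T_perm r q w \<otimes>\<^bsub>hecke_clifford r q\<^esub> hc_c r q j"
    then have "hc_class r q (fgen (Cl (w j)) * T_monom ws) = hc_class r q (T_monom ws * fgen (Cl j))"
      using wj assms(4) ws unfolding T hc_T_word_eq_class[OF ws] hc_c_eq_class
      by (simp only: hc_class_mult hc_free_closed(6) T_monom_closed)
    \<comment> \<open>Lifted to the free algebra, the two sides differ by an element of the ideal,
      so they act equally on \<open>vacuum\<close>.\<close>
    then have "fgen (Cl (w j)) * T_monom ws - T_monom ws * fgen (Cl j) \<in> hc_ideal r q"
      using wj assms(4) ws by (simp only: hc_class_eq_iff hc_free_closed(1,6) T_monom_closed)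
    from alg_act_ideal[OF this, of vacuum]
    have "gen_act q (Cl (w j)) (T_act q ws vacuum) = T_act q ws (gen_act q (Cl j) vacuum)"
      by (simp add: alg_act_simps T_act_def fun_eq_iff)
    from fun_cong[OF this[symmetric]]
    have eq: "T_act q ws (gen_act q (Cl j) vacuum) (\<lambda>a. a = b) =
        q ^ length ws * (if w j = b then 1 else 0)" for b
      by (simp add: T_act_vacuum gen_act_scale c_vacuum_coeff)
    obtain m where m: "m \<le> j" and max: "\<And>a. a \<le> j \<Longrightarrow> w a \<le> w m"
      using prefix_max_index[of j w] by blast
    obtain t where t: "q * t = 1" using assms(1) by (metis dvdE)
    have "m = j"
    proof (rule ccontr)
      assume ne: "m \<noteq> j"
      then have "w j \<noteq> w m" by (simp add: w)
      with eq[of "w m"] T_act_c_vacuum_coeff[OF t inc m max[unfolded w]] ne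
      have "q ^ length ws * (1 - t) = 0" by (simp add: w)
      \<comment> \<open>Multiplying by $t^l q$, with $l$ the length of \<open>ws\<close>, cancels
        the power of the unit and leaves $q(1-t) = q-1$.\<close>
      moreover have "(t ^ length ws * q ^ length ws) * (q * (1 - t))
          = t ^ length ws * q * (q ^ length ws * (1 - t))"
        by (simp add: mult_ac)
      ultimately have "(t ^ length ws * q ^ length ws) * (q * (1 - t)) = 0"
        by simp
      then have "q * (1 - t) = 0"
        using t by (simp add: mult.commute flip: power_mult_distrib)
      with t have "q - 1 = 0" by (simp add: algebra_simps)
      with assms(2) show False by simp
    qed
    with max have "w a \<le> w j" if "a < j" for a using that by simp
    moreover have "w a \<noteq> w j" if "a < j" for a using that by (simp add: w)
    ultimately show "\<forall>a < j. w a < w j" by (simp add: le_less)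
  qed
qed


section \<open>The permutation $d_A$\<close>

text \<open>$\widehat a$ is $\widetilde a$ for the transposed matrix; both are instances of the following.\<close>

definition block_pos :: "(nat \<Rightarrow> nat \<Rightarrow> nat) \<Rightarrow> nat \<Rightarrow> nat \<Rightarrow> nat \<Rightarrow> nat" where
  "block_pos a n i j = (\<Sum>p = 1..j - 1. \<Sum>u = 1..n. a u p) + (\<Sum>u = 1..i. a u j)"

lemma a_tilde_eq_block_pos: "a_tilde A i j = block_pos (entry A) (dim_row A) i j"
  by (simp add: a_tilde_def block_pos_def)

lemma a_hat_eq_block_pos: "a_hat A i j = block_pos (\<lambda>u p. entry A p u) (dim_col A) j i"
  by (simp add: a_hat_def block_pos_def ro_def)

lemma block_pos_step: "1 \<le> i \<Longrightarrow> block_pos a n (i - 1) j + a i j = block_pos a n i j"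
  by (cases i) (simp_all add: block_pos_def)

lemma block_pos_mono: "i \<le> i' \<Longrightarrow> block_pos a n i j \<le> block_pos a n i' j"
  unfolding block_pos_def by (intro add_left_mono sum_mono2) auto

lemma block_pos_le_columns:
  assumes "i \<le> n" "1 \<le> j" "j \<le> l"
  shows "block_pos a n i j \<le> (\<Sum>p = 1..l. \<Sum>u = 1..n. a u p)"
proof -
  have "block_pos a n i j \<le> block_pos a n n j"
    by (rule block_pos_mono) fact
  also have "\<dots> = (\<Sum>p = 1..j. \<Sum>u = 1..n. a u p)"
    using assms(2) by (cases j) (simp_all add: block_pos_def)
  also have "\<dots> \<le> (\<Sum>p = 1..l. \<Sum>u = 1..n. a u p)"
    using assms(3) by (intro sum_mono2) auto
  finally show ?thesis .
qed

text \<open>The block of $(i,j)$ ends at \<open>block_pos a n i j\<close>. Within a column,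
  monotonicity in the row compares this with later starts; the start of a block in a later column
  contains the full sum of all columns before it.\<close>

lemma block_pos_less:
  assumes "i \<in> {1..n}" "1 \<le> i'" "1 \<le> j" "p \<le> a i j" "1 \<le> p'"
    and lex: "j < j' \<or> j = j' \<and> (i < i' \<or> i = i' \<and> p < p')"
  shows "block_pos a n (i - 1) j + p < block_pos a n (i' - 1) j' + p'"
proof (cases "i = i' \<and> j = j'")
  case True
  then show ?thesis using lex by auto
next
  case False
  have "block_pos a n (i - 1) j + p \<le> block_pos a n i j"
    using block_pos_step[of i a n j] assms by simp
  also have "\<dots> \<le> block_pos a n (i' - 1) j'"
  proof (cases "j = j'")
    case True
    then show ?thesis
      using lex False by (auto intro!: block_pos_mono)
  next
    case False
    with lex have "block_pos a n i j \<le> (\<Sum>p = 1..j' - 1. \<Sum>u = 1..n. a u p)"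
      using assms by (intro block_pos_le_columns) auto
    then show ?thesis by (simp add: block_pos_def)
  qed
  finally show ?thesis using assms(5) by simp
qed

section \<open>The cells of a matrix and their two numberings\<close>

definition cells :: "nat mat \<Rightarrow> (nat \<times> nat \<times> nat) set" where
  "cells A = (SIGMA i:{1..dim_row A}. SIGMA j:{1..dim_col A}. {1..entry A i j})"

lemma mem_cells: "(i, j, p) \<in> cells A \<longleftrightarrow>
    i \<in> {1..dim_row A} \<and> j \<in> {1..dim_col A} \<and> p \<in> {1..entry A i j}"
  by (simp add: cells_def)

lemma card_cells: "card (cells A) = msum A"
  by (simp add: cells_def msum_def)

text \<open>\<open>col_pos\<close> numbers the cells column by column, \<open>row_pos\<close> row by
  row, and $d_A$ takes the first numbering to the second.\<close>

definition col_pos :: "nat mat \<Rightarrow> nat \<times> nat \<times> nat \<Rightarrow> nat" where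
  "col_pos A = (\<lambda>(i, j, p). a_tilde A (i - 1) j + p)"

definition row_pos :: "nat mat \<Rightarrow> nat \<times> nat \<times> nat \<Rightarrow> nat" where
  "row_pos A = (\<lambda>(i, j, p). a_hat A i (j - 1) + p)"

lemma col_pos_less:
  assumes "(i, j, p) \<in> cells A" "(i', j', p') \<in> cells A"
    and "j < j' \<or> j = j' \<and> (i < i' \<or> i = i' \<and> p < p')"
  shows "col_pos A (i, j, p) < col_pos A (i', j', p')"
  using assms unfolding col_pos_def prod.case a_tilde_eq_block_pos mem_cells
  by (intro block_pos_less) auto

lemma row_pos_less:
  assumes "(i, j, p) \<in> cells A" "(i', j', p') \<in> cells A"
    and "i < i' \<or> i = i' \<and> (j < j' \<or> j = j' \<and> p < p')"
  shows "row_pos A (i, j, p) < row_pos A (i', j', p')"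
  using assms unfolding row_pos_def prod.case a_hat_eq_block_pos mem_cells
  by (intro block_pos_less) auto

lemma col_pos_less_iff:
  assumes "(i, j, p) \<in> cells A" "(i', j', p') \<in> cells A"
  shows "col_pos A (i, j, p) < col_pos A (i', j', p') \<longleftrightarrow>
    j < j' \<or> j = j' \<and> (i < i' \<or> i = i' \<and> p < p')"
  using col_pos_less[OF assms] col_pos_less[OF assms(2,1)]
  by (metis linorder_neqE_nat order.asym)

lemma row_pos_less_iff:
  assumes "(i, j, p) \<in> cells A" "(i', j', p') \<in> cells A"
  shows "row_pos A (i, j, p) < row_pos A (i', j', p') \<longleftrightarrow>
    i < i' \<or> i = i' \<and> (j < j' \<or> j = j' \<and> p < p')"
  using row_pos_less[OF assms] row_pos_less[OF assms(2,1)]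
  by (metis linorder_neqE_nat order.asym)

lemma bij_betw_of_inj_on_card:
  assumes "inj_on f S" "f ` S \<subseteq> T" "finite T" "card S = card T"
  shows "bij_betw f S T"
  using assms by (simp add: bij_betw_def card_image card_subset_eq)

text \<open>Injectivity follows from strict monotonicity for a total lexicographic order, and
  surjectivity by counting cells.\<close>

lemma bij_betw_col_pos: "bij_betw (col_pos A) (cells A) {1..msum A}"
proof (rule bij_betw_of_inj_on_card)
  show "inj_on (col_pos A) (cells A)"
  proof (rule inj_onI)
    fix x y
    assume c: "x \<in> cells A" "y \<in> cells A" "col_pos A x = col_pos A y"
    obtain i j p i' j' p' where xy: "x = (i, j, p)" "y = (i', j', p')"
      by (metis prod_cases3)
    show "x = y"
      using c col_pos_less_iff[of i j p A i' j' p'] col_pos_less_iff[of i' j' p' A i j p]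
      unfolding xy by auto
  qed
  show "col_pos A ` cells A \<subseteq> {1..msum A}"
  proof (clarify, unfold mem_cells)
    fix i j p
    assume c: "i \<in> {1..dim_row A} \<and> j \<in> {1..dim_col A} \<and> p \<in> {1..entry A i j}"
    then have "col_pos A (i, j, p) \<le> block_pos (entry A) (dim_row A) i j"
      using block_pos_step[of i "entry A" "dim_row A" j] by (simp add: col_pos_def a_tilde_eq_block_pos)
    also have "\<dots> \<le> (\<Sum>p = 1..dim_col A. \<Sum>u = 1..dim_row A. entry A u p)"
      using c by (intro block_pos_le_columns) auto
    also have "\<dots> = msum A"
      unfolding msum_def by (rule sum.swap)
    finally show "col_pos A (i, j, p) \<in> {1..msum A}"
      using c by (simp add: col_pos_def)
  qed
qed (simp_all add: card_cells)

lemma bij_betw_row_pos: "bij_betw (row_pos A) (cells A) {1..msum A}"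
proof (rule bij_betw_of_inj_on_card)
  show "inj_on (row_pos A) (cells A)"
  proof (rule inj_onI)
    fix x y
    assume c: "x \<in> cells A" "y \<in> cells A" "row_pos A x = row_pos A y"
    obtain i j p i' j' p' where xy: "x = (i, j, p)" "y = (i', j', p')"
      by (metis prod_cases3)
    show "x = y"
      using c row_pos_less_iff[of i j p A i' j' p'] row_pos_less_iff[of i' j' p' A i j p]
      unfolding xy by auto
  qed
  show "row_pos A ` cells A \<subseteq> {1..msum A}"
  proof (clarify, unfold mem_cells)
    fix i j p
    assume c: "i \<in> {1..dim_row A} \<and> j \<in> {1..dim_col A} \<and> p \<in> {1..entry A i j}"
    then have "row_pos A (i, j, p) \<le> block_pos (\<lambda>u p. entry A p u) (dim_col A) j i"
      using block_pos_step[of j "\<lambda>u p. entry A p u" "dim_col A" i]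
      by (simp add: row_pos_def a_hat_eq_block_pos)
    also have "\<dots> \<le> msum A"
      unfolding msum_def using c by (intro block_pos_le_columns) auto
    finally show "row_pos A (i, j, p) \<in> {1..msum A}"
      using c by (simp add: row_pos_def)
  qed
qed (simp_all add: card_cells)

text \<open>The description in \<open>d_perm\<close> has a unique solution: \<open>row_pos\<close>
  after the inverse of \<open>col_pos\<close>, extended by the identity. It is unique because
  \<open>col_pos\<close> reaches every position in the range and permutations of the range fix the
  rest.\<close>

lemma d_perm_spec:
  "d_perm A permutes {1..msum A} \<and> (\<forall>x \<in> cells A. d_perm A (col_pos A x) = row_pos A x)"
proof -
  let ?P = "\<lambda>d. d permutes {1..msum A} \<and> (\<forall>x \<in> cells A. d (col_pos A x) = row_pos A x)"
  let ?inv = "inv_into (cells A) (col_pos A)"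
  define d where "d y = (if y \<in> {1..msum A} then row_pos A (?inv y) else y)" for y
  have "bij_betw (row_pos A \<circ> ?inv) {1..msum A} {1..msum A}"
    using bij_betw_inv_into[OF bij_betw_col_pos] bij_betw_row_pos by (rule bij_betw_trans)
  then have "bij_betw d {1..msum A} {1..msum A}"
    by (rule bij_betw_cong[THEN iffD1, rotated]) (simp add: d_def)
  then have "d permutes {1..msum A}"
    by (rule bij_imp_permutes) (auto simp: d_def)
  moreover have "d (col_pos A x) = row_pos A x" if "x \<in> cells A" for x
    using that bij_betw_apply[OF bij_betw_col_pos that]
      bij_betw_inv_into_left[OF bij_betw_col_pos that] by (simp add: d_def)
  ultimately have d: "?P d" by blast
  have uniq: "e = d" if e: "?P e" for e
  proof
    fix y
    show "e y = d y"
    proof (cases "y \<in> {1..msum A}")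
      case True
      then obtain x where "x \<in> cells A" "y = col_pos A x"
        using bij_betw_imp_surj_on[OF bij_betw_col_pos] by blast
      with e d show ?thesis by simp
    next
      case False
      with e d show ?thesis by (metis permutes_not_in)
    qed
  qed
  have "d_perm A = (THE d. ?P d)"
    unfolding d_perm_def
    by (rule arg_cong[where f = The]) (auto simp: fun_eq_iff cells_def col_pos_def row_pos_def)
  then show ?thesis
    using theI[of ?P, OF d uniq] by simp
qed

text \<open>A cell that precedes another column by column but follows it row by row shares neither
  its row nor its column, so it lies strictly below and to the left.\<close>

lemma d_perm_inversion_iff:
  assumes "(h, k, p) \<in> cells A"
  shows "(\<exists>a < col_pos A (h, k, p). d_perm A (col_pos A (h, k, p)) < d_perm A a) \<longleftrightarrow>
    (\<exists>i \<in> {h<..dim_row A}. \<exists>j \<in> {1..<k}. 0 < entry A i j)"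
proof
  note perm = d_perm_spec[of A, THEN conjunct1]
  assume "\<exists>a < col_pos A (h, k, p). d_perm A (col_pos A (h, k, p)) < d_perm A a"
  then obtain a where a: "a < col_pos A (h, k, p)" "row_pos A (h, k, p) < d_perm A a"
    using d_perm_spec assms by metis
  \<comment> \<open>The bound on \<open>a\<close> admits \<open>a = 0\<close>, which $d_A$ fixes and
    which therefore gives no inversion.\<close>
  have "a \<in> {1..msum A}"
  proof (rule ccontr)
    assume "a \<notin> {1..msum A}"
    then have "d_perm A a = a" "a = 0"
      using perm a bij_betw_apply[OF bij_betw_col_pos assms] by (auto simp: permutes_not_in)
    with a show False by simp
  qed
  then obtain x where "x \<in> cells A" "a = col_pos A x"
    using bij_betw_imp_surj_on[OF bij_betw_col_pos] by blast
  then obtain i j u where c: "(i, j, u) \<in> cells A" and "a = col_pos A (i, j, u)"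
    by (cases x) auto
  with a have "col_pos A (i, j, u) < col_pos A (h, k, p)" "row_pos A (h, k, p) < row_pos A (i, j, u)"
    using d_perm_spec by auto
  then have "h < i \<and> j < k"
    using col_pos_less_iff[OF c assms] row_pos_less_iff[OF assms c] by auto
  moreover have "0 < entry A i j" "i \<le> dim_row A" "1 \<le> j"
    using c by (auto simp: mem_cells)
  ultimately show "\<exists>i \<in> {h<..dim_row A}. \<exists>j \<in> {1..<k}. 0 < entry A i j"
    by (meson atLeastLessThan_iff greaterThanAtMost_iff)
next
  assume "\<exists>i \<in> {h<..dim_row A}. \<exists>j \<in> {1..<k}. 0 < entry A i j"
  then obtain i j where ij: "i \<in> {h<..dim_row A}" "j \<in> {1..<k}" "0 < entry A i j" by blast
  with assms have "(i, j, 1) \<in> cells A" by (auto simp: mem_cells)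
  with ij assms show "\<exists>a < col_pos A (h, k, p). d_perm A (col_pos A (h, k, p)) < d_perm A a"
    by (intro exI[of _ "col_pos A (i, j, 1)"]) (simp add: d_perm_spec col_pos_less row_pos_less)
qed

section \<open>The lower left corner and the SDP condition\<close>

lemma pick_atLeastLessThan: "i < b - a \<Longrightarrow> pick {a..<b} i = a + i"
proof (induction i)
  case 0
  then show ?case by (auto intro!: Least_equality)
next
  case (Suc i)
  then show ?case by (auto intro!: Least_equality)
qed

lemma lower_left_corner_eq_0_iff:
  assumes "h \<le> dim_row A" "k - 1 \<le> dim_col A"
  shows "lower_left_corner A h k = 0\<^sub>m (dim_row A - h) (k - 1) \<longleftrightarrow>
    (\<forall>i \<in> {h<..dim_row A}. \<forall>j \<in> {1..<k}. entry A i j = 0)"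
proof -
  have rows: "{i. i < dim_row A \<and> i \<in> {h..<dim_row A}} = {h..<dim_row A}" by auto
  have cols: "{j. j < dim_col A \<and> j \<in> {..<k - 1}} = {..<k - 1}" using assms by auto
  have "lower_left_corner A h k = mat (dim_row A - h) (k - 1) (\<lambda>(i, j). A $$ (h + i, j))"
    unfolding lower_left_corner_def submatrix_def rows cols
    by (rule eq_matI) (simp_all add: pick_atLeastLessThan lessThan_atLeast0 del: pick.simps)
  then have "lower_left_corner A h k = 0\<^sub>m (dim_row A - h) (k - 1) \<longleftrightarrow>
      (\<forall>i < dim_row A - h. \<forall>j < k - 1. entry A (Suc (h + i)) (Suc j) = 0)"
    by (auto simp: mat_eq_iff entry_def)
  also have "\<dots> \<longleftrightarrow> (\<forall>i \<in> {h<..dim_row A}. \<forall>j \<in> {1..<k}. entry A i j = 0)"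
  proof (intro iffI ballI allI impI)
    fix i j
    assume "\<forall>i < dim_row A - h. \<forall>j < k - 1. entry A (Suc (h + i)) (Suc j) = 0"
      and ij: "i \<in> {h<..dim_row A}" "j \<in> {1..<k}"
    \<comment> \<open>Entry $(i,j)$, counted from 1, sits in the corner at row
      \<open>i - Suc h\<close> and column \<open>j - 1\<close>, counted from 0.\<close>
    moreover from ij have "i - Suc h < dim_row A - h" "j - 1 < k - 1" by auto
    ultimately have "entry A (Suc (h + (i - Suc h))) (Suc (j - 1)) = 0" by blast
    with ij show "entry A i j = 0" by simp
  qed auto
  finally show ?thesis .
qed

lemma SDP_iff:
  fixes q :: "'a::comm_ring_1"
  assumes "q dvd 1" "q \<noteq> 1" "h \<in> {1..dim_row A}" "k \<in> {1..dim_col A}"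
  shows "SDP A q h k \<longleftrightarrow>
    0 < entry A h k \<and> (\<forall>i \<in> {h<..dim_row A}. \<forall>j \<in> {1..<k}. entry A i j = 0)"
proof -
  have "hc_c (msum A) q (a_hat A h (k - 1) + p)
          \<otimes>\<^bsub>hecke_clifford (msum A) q\<^esub> hc_T_perm (msum A) q (d_perm A)
        = hc_T_perm (msum A) q (d_perm A)
          \<otimes>\<^bsub>hecke_clifford (msum A) q\<^esub> hc_c (msum A) q (a_tilde A (h - 1) k + p)
      \<longleftrightarrow> (\<forall>i \<in> {h<..dim_row A}. \<forall>j \<in> {1..<k}. entry A i j = 0)"
    if "p \<in> {1..entry A h k}" for p
  proof -
    have cell: "(h, k, p) \<in> cells A"
      using assms that by (simp add: mem_cells)
    let ?j = "col_pos A (h, k, p)"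
    have perm: "d_perm A permutes {1..msum A}" and d: "d_perm A ?j = row_pos A (h, k, p)"
      using d_perm_spec cell by blast+
    have "?j \<in> {1..msum A}"
      using bij_betw_col_pos cell by (rule bij_betw_apply)
    from hc_c_T_perm_commute_iff[OF assms(1,2) perm this]
    have "hc_c (msum A) q (row_pos A (h, k, p))
          \<otimes>\<^bsub>hecke_clifford (msum A) q\<^esub> hc_T_perm (msum A) q (d_perm A)
        = hc_T_perm (msum A) q (d_perm A)
          \<otimes>\<^bsub>hecke_clifford (msum A) q\<^esub> hc_c (msum A) q ?j
      \<longleftrightarrow> (\<forall>a < ?j. d_perm A a < d_perm A ?j)"
      unfolding d .
    also have "\<dots> \<longleftrightarrow> \<not> (\<exists>a < ?j. d_perm A ?j < d_perm A a)"
      \<comment> \<open>Injectivity rules out equal values, so the negation of an ascent is an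
        inversion.\<close>
      using permutes_inj[OF perm] by (metis inj_eq linorder_neqE_nat order.asym order.irrefl)
    also have "\<dots> \<longleftrightarrow> (\<forall>i \<in> {h<..dim_row A}. \<forall>j \<in> {1..<k}. entry A i j = 0)"
      unfolding d_perm_inversion_iff[OF cell] by auto
    finally show ?thesis
      by (simp add: col_pos_def row_pos_def)
  qed
  \<comment> \<open>The condition obtained is the same for every \<open>p\<close>, and a positive
    entry provides \<open>p = 1\<close>, so the quantifier over \<open>p\<close> disappears.\<close>
  then show ?thesis
    unfolding SDP_def by (metis Suc_leI atLeastAtMost_iff One_nat_def order_refl)
qed

theorem theorem4p6:
  fixes q :: "'a::comm_ring_1" and A :: "nat mat" and n h k :: nat
  assumes "q dvd 1" and "q \<noteq> 1"
    and "A \<in> carrier_mat n n"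
    and "h \<in> {1..n}" and "k \<in> {1..n}"
  shows "(SDP A q h k \<longleftrightarrow>
            entry A h k > 0 \<and>
            (\<forall>i \<in> {1..n}. \<forall>j \<in> {1..n}. i > h \<and> j < k \<longrightarrow> entry A i j = 0))
       \<and> (SDP A q h k \<longleftrightarrow>
            entry A h k > 0 \<and> lower_left_corner A h k = 0\<^sub>m (n - h) (k - 1))"
proof -
  have dims: "dim_row A = n" "dim_col A = n"
    using assms(3) by auto
  have "(\<forall>i \<in> {1..n}. \<forall>j \<in> {1..n}. i > h \<and> j < k \<longrightarrow> entry A i j = 0) \<longleftrightarrow>
      (\<forall>i \<in> {h<..n}. \<forall>j \<in> {1..<k}. entry A i j = 0)"
    using assms(5) by auto
  moreover have "lower_left_corner A h k = 0\<^sub>m (n - h) (k - 1) \<longleftrightarrow>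
      (\<forall>i \<in> {h<..n}. \<forall>j \<in> {1..<k}. entry A i j = 0)"
    using lower_left_corner_eq_0_iff[of h A k] assms(4,5) by (auto simp: dims)
  ultimately show ?thesis
    using SDP_iff[OF assms(1,2), of h A k] assms(4,5) by (simp add: dims)
qed

end
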